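(* Let $m$ be a natural number. If $m=5$ or $m>6$, then $\psi_{\mathbb{Z}^2}(m)\geq m+1$.
   Context: A direction is a nonzero vector $s\in\mathbb{R}^2$. For a finite set $F\subseteq\mathbb{Z}^2$, the (discrete) X-ray of $F$ in direction $s$ is the function that assigns to each line parallel to $s$ the number of points of $F$ on that line. $\psi_{\mathbb{Z}^2}(m)$ denotes the minimum number $n$ for which there exist $m$ directions $s_1,\dots,s_m$, pairwise linearly independent and spanning $\mathbb{R}^2$, such that there are two different $n$-point sets in $\mathbb{Z}^2$ that have the same X-rays in each of the directions $s_1,\dots,s_m$. *)

theory Defs
  imports "HOL-Analysis.Analysis"
begin

definition integer_lattice :: "(real^2) set" where
  "integer_lattice = {x. \<forall>i. x $ i \<in> \<int>}"

definition parallel_lines :: "real^2 \<Rightarrow> (real^2) set set" where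
  "parallel_lines s = {L. \<exists>p. L = {p + t *\<^sub>R s |t. t \<in> UNIV}}"

text \<open>The domain is restricted so that equality of X-rays means equality
  as functions on the lines parallel to \<open>s\<close>.\<close>
definition xray :: "real^2 \<Rightarrow> (real^2) set \<Rightarrow> (real^2) set \<Rightarrow> nat" where
  "xray s F = (\<lambda>L\<in>parallel_lines s. card (F \<inter> L))"

text \<open>Distinctness is stated explicitly, since for \<open>s i = s j\<close>
  the set \<open>{s i, s j}\<close> would collapse to an independent singleton.\<close>
definition admissible_directions :: "nat \<Rightarrow> (nat \<Rightarrow> real^2) \<Rightarrow> bool" where
  "admissible_directions m s \<longleftrightarrow>
     (\<forall>i\<in>{1..m}. s i \<noteq> 0) \<and>
     (\<forall>i\<in>{1..m}. \<forall>j\<in>{1..m}. i \<noteq> j \<longrightarrow> s i \<noteq> s j \<and> independent {s i, s j}) \<and>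
     span (s ` {1..m}) = UNIV"

definition psi :: "nat \<Rightarrow> nat" where
  "psi m = (LEAST n. \<exists>s. admissible_directions m s \<and>
     (\<exists>F G. F \<subseteq> integer_lattice \<and> G \<subseteq> integer_lattice \<and>
        finite F \<and> finite G \<and> card F = n \<and> card G = n \<and> F \<noteq> G \<and>
        (\<forall>i\<in>{1..m}. xray (s i) F = xray (s i) G)))"

end

theory Submission
  imports Defs
begin

text \<open>
  Suppose that two different sets \<open>F\<close>, \<open>G\<close> of \<open>n \<le> m\<close> lattice points have equal X-rays in \<open>m\<close>
  pairwise independent directions.  On each of the \<open>m\<close> lines through a point of \<open>F - G\<close> there is a
  point of \<open>G - F\<close>, and these points are distinct.  Hence \<open>n = m\<close>, the sets are disjoint, and every
  X-ray line that meets \<open>P = F \<union> G\<close> contains exactly two points of \<open>P\<close>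
  (\<open>few_points_force_unique_partners\<close>, \<open>matched_configuration_of_xrays\<close>).

  Consequently each of the \<open>2 m\<close> supporting lines of \<open>P\<close> in an X-ray direction carries an edge of the
  convex hull.  A convex polygon with \<open>2 m\<close> edges needs \<open>2 m\<close> vertices, so all points of \<open>P\<close> are
  vertices of this polygon, say \<open>v 0, v 1, \<dots>\<close> in cyclic order.  Seen from the edge
  \<open>v k\<close>, \<open>v (k + 1)\<close>, the next lines of its direction carry the pairs
  \<open>v (k - 1)\<close>, \<open>v (k + 2)\<close> and \<open>v (k - 2)\<close>, \<open>v (k + 3)\<close> (\<open>chords_parallel_to_edge\<close>).
  For the side vectors \<open>e k = v (k + 1) - v k\<close> the first fact says
  \<open>e (k - 1) + e (k + 1) = t k *\<^sub>R e k\<close>, and the second one forces \<open>t (k - 1) = t (k + 1)\<close>.  Therefore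
  \<open>e (k - 2) + e (k + 2) = \<tau> *\<^sub>R e k\<close> with one constant \<open>\<tau>\<close>
  (\<open>three_term_recurrence_of_sides\<close>): the linear map with \<open>e k \<mapsto> e (k + 2)\<close> shifts the sides
  by two and has trace \<open>\<tau>\<close>.

  This is where the lattice enters.  A periodic nonzero integer sequence can satisfy such a recurrence
  only if \<open>\<tau>\<close> is an integer of absolute value at most 2 (\<open>integer_recurrence\<close>, the crystallographic
  restriction).  Then \<open>e (2 * n) = e 0\<close> for some \<open>n \<in> {1, 2, 3, 4, 6}\<close>; as a convex polygon does not
  repeat a side vector, \<open>m\<close> divides \<open>n\<close>, so for \<open>m > 2\<close> only 3, 4 and 6 remain
  (\<open>lattice_configuration_order\<close>).

  The number \<open>psi m\<close> is defined as a least element, hence one also needs that some pair of sets with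
  equal X-rays exists (\<open>switching_component_exists\<close>).
\<close>

section \<open>The wedge product in the plane\<close>

definition wedge :: "real^2 \<Rightarrow> real^2 \<Rightarrow> real" where
  "wedge x y = x $ 1 * y $ 2 - x $ 2 * y $ 1"

lemma wedge_self [simp]: "wedge x x = 0"
  by (simp add: wedge_def)

lemma wedge_zero_right [simp]: "wedge x 0 = 0"
  by (simp add: wedge_def)

lemma wedge_minus_left [simp]: "wedge (- x) y = - wedge x y"
  by (simp add: wedge_def)

lemma wedge_minus_right [simp]: "wedge x (- y) = - wedge x y"
  by (simp add: wedge_def)

lemma wedge_add_right: "wedge x (y + z) = wedge x y + wedge x z"
  by (simp add: wedge_def algebra_simps)

lemma wedge_diff_right: "wedge x (y - z) = wedge x y - wedge x z"
  by (simp add: wedge_def algebra_simps)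

lemma wedge_scaleR_left [simp]: "wedge (c *\<^sub>R x) y = c * wedge x y"
  by (simp add: wedge_def algebra_simps)

lemma wedge_scaleR_right [simp]: "wedge x (c *\<^sub>R y) = c * wedge x y"
  by (simp add: wedge_def algebra_simps)

lemma wedge_swap: "wedge x y = - wedge y x"
  by (simp add: wedge_def)

lemma parallel_if_wedge_eq_0:
  assumes "d \<noteq> 0" "wedge d u = 0"
  obtains c where "u = c *\<^sub>R d"
proof (cases "d $ 1 = 0")
  case True
  then have "d $ 2 \<noteq> 0" using assms(1) by (auto simp: vec_eq_iff forall_2)
  then have "u = (u $ 2 / d $ 2) *\<^sub>R d" using assms(2) True
    by (simp add: vec_eq_iff forall_2 wedge_def)
  then show ?thesis by (rule that)
next
  case False
  then have "u = (u $ 1 / d $ 1) *\<^sub>R d" using assms(2)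
    by (simp add: vec_eq_iff forall_2 wedge_def field_simps)
  then show ?thesis by (rule that)
qed

lemma finite_minimizer:
  fixes f :: "'a \<Rightarrow> real"
  assumes "finite A" "A \<noteq> {}"
  obtains z where "z \<in> A" "\<forall>w\<in>A. f z \<le> f w"
  using ex_is_arg_min_if_finite[OF assms, of f] by (auto simp: is_arg_min_linorder)

section \<open>Point sets in which every direction is a perfect matching\<close>

text \<open>The union of two extremal sets, with the colours forgotten: \<open>S\<close> holds both orientations
  of the \<open>m\<close> X-ray directions, and the lines of each direction pair up the points of \<open>P\<close>.\<close>
locale matched_configuration =
  fixes P S :: "(real^2) set" and m :: nat
  assumes finite_P: "finite P"
    and card_P: "card P = 2 * m"
    and card_S: "card S = 2 * m"
    and m_gt_2: "2 < m"
    and nonzero: "d \<in> S \<Longrightarrow> d \<noteq> 0"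
    and uminus_closed: "d \<in> S \<Longrightarrow> - d \<in> S"
    and parallel_cases: "\<lbrakk>d \<in> S; d' \<in> S; wedge d d' = 0\<rbrakk> \<Longrightarrow> d' = d \<or> d' = - d"
    and partner: "\<lbrakk>d \<in> S; p \<in> P\<rbrakk> \<Longrightarrow> \<exists>!q. q \<in> P \<and> q \<noteq> p \<and> wedge d (q - p) = 0"
begin

text \<open>A hull edge traversed counterclockwise: the whole set lies to the left of it.\<close>
definition edge :: "real^2 \<Rightarrow> real^2 \<Rightarrow> real^2 \<Rightarrow> bool" where
  "edge d p q \<longleftrightarrow> d \<in> S \<and> p \<in> P \<and> q \<in> P \<and> (\<exists>c>0. q - p = c *\<^sub>R d)
     \<and> (\<forall>z\<in>P. 0 \<le> wedge d (z - p))"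

lemma partner_unique:
  assumes "d \<in> S" "p \<in> P" "q \<in> P" "r \<in> P" "q \<noteq> p" "r \<noteq> p"
    "wedge d (q - p) = 0" "wedge d (r - p) = 0"
  shows "q = r"
  using partner[OF assms(1,2)] assms by blast

lemma edgeD:
  assumes "edge d p q"
  shows "d \<in> S" "p \<in> P" "q \<in> P" "p \<noteq> q" "wedge d (q - p) = 0" "wedge d q = wedge d p"
    "z \<in> P \<Longrightarrow> 0 \<le> wedge d (z - p)" "z \<in> P \<Longrightarrow> 0 \<le> wedge d (z - q)"
proof -
  obtain c where c: "c > 0" "q - p = c *\<^sub>R d" using assms by (auto simp: edge_def)
  show d: "d \<in> S" and "p \<in> P" "q \<in> P" using assms by (auto simp: edge_def)
  show "p \<noteq> q" using c nonzero[OF d] by auto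
  show *: "wedge d (q - p) = 0" using c by simp
  then show **: "wedge d q = wedge d p" by (simp add: wedge_diff_right)
  show "0 \<le> wedge d (z - p)" if "z \<in> P" using assms that by (auto simp: edge_def)
  then show "0 \<le> wedge d (z - q)" if "z \<in> P" using that ** by (simp add: wedge_diff_right)
qed

lemma bottom_level:
  assumes "edge d p q" "z \<in> P" "wedge d (z - p) = 0"
  shows "z = p \<or> z = q"
  using partner_unique[of d p q z] edgeD[OF assms(1)] assms(2,3) by blast

lemma oriented_level:
  assumes "d \<in> S" "z \<in> P"
  obtains x y c where "x \<in> P" "y \<in> P" "z = x \<or> z = y" "c > 0" "y - x = c *\<^sub>R d"
proof -
  obtain q where q: "q \<in> P" "q \<noteq> z" "wedge d (q - z) = 0" using partner[OF assms] by blast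
  obtain c where c: "q - z = c *\<^sub>R d"
    using parallel_if_wedge_eq_0[OF nonzero[OF assms(1)] q(3)] .
  have "c \<noteq> 0" using c q by auto
  then consider "c > 0" | "- c > 0" by linarith
  then show ?thesis
  proof cases
    case 1 then show ?thesis using that[of z q c] assms q c by blast
  next
    case 2
    have "z - q = (- c) *\<^sub>R d" using c by (simp add: algebra_simps)
    then show ?thesis using that[of q z "- c"] assms q 2 by blast
  qed
qed

lemma edge_exists:
  assumes "d \<in> S"
  shows "\<exists>p q. edge d p q"
proof -
  have "P \<noteq> {}" using card_P m_gt_2 by auto
  then obtain z where z: "z \<in> P" "\<forall>w\<in>P. wedge d z \<le> wedge d w"
    by (rule finite_minimizer[OF finite_P])
  obtain x y c where xy: "x \<in> P" "y \<in> P" "z = x \<or> z = y" "c > 0" "y - x = c *\<^sub>R d"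
    using oriented_level[OF assms z(1)] .
  have "wedge d (y - x) = 0" using xy by simp
  then have "wedge d y = wedge d x" unfolding wedge_diff_right by simp
  then have "wedge d x = wedge d z" using xy(3) by auto
  then have "edge d x y" using xy z assms by (auto simp: edge_def wedge_diff_right)
  then show ?thesis by blast
qed

lemma not_collinear:
  assumes "d \<in> S" "p \<in> P"
  shows "\<exists>z\<in>P. wedge d (z - p) \<noteq> 0"
proof (rule ccontr)
  assume *: "\<not> ?thesis"
  obtain q where q: "q \<in> P" "q \<noteq> p" "wedge d (q - p) = 0" using partner[OF assms] by blast
  have "P \<subseteq> {p, q}" using * partner_unique[OF assms q(1)] q by blast
  then have "card P \<le> card {p, q}" by (intro card_mono) auto
  also have "\<dots> \<le> 2" using card_length[of "[p, q]"] by simp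
  finally show False using card_P m_gt_2 by simp
qed

lemma edge_dir_determines:
  assumes "edge d p q" "edge d p' q'"
  shows "p' = p \<and> q' = q"
proof -
  note e = edgeD[OF assms(1)] and e' = edgeD[OF assms(2)]
  obtain c where c: "c > 0" "q - p = c *\<^sub>R d" using assms by (auto simp: edge_def)
  obtain c' where c': "c' > 0" "q' - p' = c' *\<^sub>R d" using assms by (auto simp: edge_def)
  have lev: "wedge d (p' - p) = 0" using e(7)[OF e'(2)] e'(7)[OF e(2)]
    by (simp add: wedge_diff_right)
  then have lev': "wedge d (q' - p) = 0" using e'(6) by (simp add: wedge_diff_right)
  have "p' = p \<or> p' = q" "q' = p \<or> q' = q"
    using bottom_level[OF assms(1)] lev lev' e' by blast+
  moreover have False if "p' = q" "q' = p"
  proof -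
    have "(c + c') *\<^sub>R d = 0" using c(2) c'(2) that by (simp add: scaleR_left_distrib flip: c(2) c'(2))
    then show False using c(1) c'(1) nonzero[OF e(1)] by simp
  qed
  ultimately show ?thesis using e'(4) by blast
qed

lemma opposite_edges_disjoint:
  assumes "edge d p q" "edge (- d) p' q'"
  shows "{p, q} \<inter> {p', q'} = {}"
proof (rule ccontr)
  assume "\<not> ?thesis"
  then have "wedge d p = wedge d p'"
    using edgeD(6)[OF assms(1)] edgeD(6)[OF assms(2)] by auto
  then have "wedge d (z - p) = 0" if "z \<in> P" for z
    using edgeD(7)[OF assms(1) that] edgeD(7)[OF assms(2) that]
    by (simp add: wedge_diff_right)
  then show False using not_collinear edgeD[OF assms(1)] by blast
qed

text \<open>If two edges of different directions ended in \<open>q\<close>, each of their starting points would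
  have to lie to the left of the other edge, which forces the directions to be opposite.  Then
  \<open>P\<close> would be squeezed between two coinciding supporting lines.\<close>
lemma edge_head_determines_dir:
  assumes "edge d p q" "edge d' p' q"
  shows "d' = d"
proof -
  note e = edgeD[OF assms(1)] and e' = edgeD[OF assms(2)]
  obtain c where c: "c > 0" "q - p = c *\<^sub>R d" using assms by (auto simp: edge_def)
  obtain c' where c': "c' > 0" "q - p' = c' *\<^sub>R d'" using assms by (auto simp: edge_def)
  have "p' - q = - (c' *\<^sub>R d')" "p - q = - (c *\<^sub>R d)" by (simp_all flip: c(2) c'(2))
  then have "0 \<le> - (c' * wedge d d')" "0 \<le> - (c * wedge d' d)"
    using e(8)[OF e'(2)] e'(8)[OF e(2)] by simp_all
  then have "wedge d d' \<le> 0" "wedge d' d \<le> 0" using c(1) c'(1)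
    by (simp_all add: mult_le_0_iff)
  then have "wedge d d' = 0" using wedge_swap[of d d'] by linarith
  then show ?thesis using parallel_cases[OF e(1) e'(1)] opposite_edges_disjoint[OF assms(1)] assms(2)
    by blast
qed

lemma edge_tail_determines_dir:
  assumes "edge d p q" "edge d' p q'"
  shows "d' = d"
proof -
  note e = edgeD[OF assms(1)] and e' = edgeD[OF assms(2)]
  obtain c where c: "c > 0" "q - p = c *\<^sub>R d" using assms by (auto simp: edge_def)
  obtain c' where c': "c' > 0" "q' - p = c' *\<^sub>R d'" using assms by (auto simp: edge_def)
  have "0 \<le> c' * wedge d d'" "0 \<le> c * wedge d' d"
    using e(7)[OF e'(3)] e'(7)[OF e(3)] c(2) c'(2) by simp_all
  then have "wedge d d' \<ge> 0" "wedge d' d \<ge> 0" using c(1) c'(1)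
    by (simp_all add: zero_le_mult_iff)
  then have "wedge d d' = 0" using wedge_swap[of d d'] by linarith
  then show ?thesis using parallel_cases[OF e(1) e'(1)] opposite_edges_disjoint[OF assms(1)] assms(2)
    by blast
qed

text \<open>There are as many edges as directions, hence as many as points, and no two edges share a
  starting point or an end point.  So by counting every point of \<open>P\<close> is a vertex of the hull.\<close>
lemma edge_from: "p \<in> P \<Longrightarrow> \<exists>d q. edge d p q"
  and edge_into: "p \<in> P \<Longrightarrow> \<exists>d q. edge d q p"
proof -
  obtain f g where fg: "edge d (f d) (g d)" if "d \<in> S" for d using edge_exists by metis
  have "inj_on f S" "inj_on g S"
    using fg edge_tail_determines_dir edge_head_determines_dir by (metis inj_onI)+
  moreover have "f ` S \<subseteq> P" "g ` S \<subseteq> P" using edgeD(2,3)[OF fg] by blast+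
  ultimately have "f ` S = P" "g ` S = P"
    using card_S card_P finite_P by (metis card_image card_subset_eq)+
  then show "p \<in> P \<Longrightarrow> \<exists>d q. edge d p q" "p \<in> P \<Longrightarrow> \<exists>d q. edge d q p"
    using fg by (metis imageE)+
qed

definition succ :: "real^2 \<Rightarrow> real^2" where
  "succ p = (SOME q. \<exists>d. edge d p q)"

lemma edge_succ: "p \<in> P \<Longrightarrow> \<exists>d. edge d p (succ p)"
  unfolding succ_def by (rule someI_ex) (use edge_from in blast)

lemma succ_eq: "edge d p q \<Longrightarrow> succ p = q"
  using edge_succ[of p] edgeD(2) edge_tail_determines_dir edge_dir_determines by metis

lemma succ_in: "p \<in> P \<Longrightarrow> succ p \<in> P"
  using edge_succ edgeD by blast

lemma inj_succ: "inj_on succ P"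
  by (intro inj_onI) (metis edge_succ edge_head_determines_dir edge_dir_determines)

text \<open>The configuration is scanned by lines parallel to the edge \<open>p\<close>, \<open>q\<close>, the height of a
  point being its wedge with \<open>d\<close>.  On any line above the edge, the boundary walk reaches the front
  point \<open>y\<close> while ascending: since the rear point \<open>x\<close> is to the left of the edge into \<open>y\<close>, this edge
  cannot descend.  Nor is it horizontal: in direction \<open>d\<close> it would lie on the bottom line, and in
  direction \<open>- d\<close> it would start in a second partner of \<open>y\<close>.\<close>
lemma pred_below:
  assumes d: "edge d p q" and "x \<in> P" "y \<in> P" "c > 0" "y - x = c *\<^sub>R d"
    and pos: "0 < wedge d (y - p)" and g: "edge g w y"
  shows "wedge d (w - p) < wedge d (y - p)"
proof -
  note gD = edgeD[OF g] and dD = edgeD[OF d]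
  obtain b where b: "b > 0" "y - w = b *\<^sub>R g" using g by (auto simp: edge_def)
  have x: "x = y - c *\<^sub>R d" using assms(5) by (simp add: algebra_simps)
  have w: "w = y - b *\<^sub>R g" using b(2) by (simp add: algebra_simps)
  have "0 \<le> wedge g (x - y)" using gD(8) assms by blast
  then have "c * wedge g d \<le> 0" using x by simp
  then have ge: "0 \<le> wedge d g" using assms(4) wedge_swap[of d g] by (simp add: mult_le_0_iff)
  have ne: "wedge d g \<noteq> 0"
  proof
    assume 0: "wedge d g = 0"
    then consider "g = d" | "g = - d" using parallel_cases dD gD by blast
    then show False
    proof cases
      case 1
      then show False using gD(8)[OF dD(2)] pos by (simp add: wedge_diff_right)
    next
      case 2
      have "wedge d (x - y) = 0" "wedge d (w - y) = 0" using x w 0 by simp_all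
      moreover have "x \<noteq> y" using x assms(4) nonzero[OF dD(1)] by simp
      ultimately have "x = w" using partner_unique[of d y x w] dD gD assms by blast
      then have "(b + c) *\<^sub>R d = 0" using x w 2
        by (simp add: scaleR_left_distrib neg_eq_iff_add_eq_0 add.commute)
      then show False using b(1) assms(4) nonzero[OF dD(1)] by simp
    qed
  qed
  have "wedge d (w - p) = wedge d (y - p) - b * wedge d g"
    using w by (simp add: wedge_diff_right)
  moreover have "0 < b * wedge d g" using b(1) ge ne by simp
  ultimately show ?thesis by linarith
qed

text \<open>The mirror image: the boundary walk leaves the rear point of a line while descending.\<close>
lemma succ_below:
  assumes d: "edge d p q" and "x \<in> P" "y \<in> P" "c > 0" "y - x = c *\<^sub>R d"
    and pos: "0 < wedge d (x - p)" and g: "edge g x w"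
  shows "wedge d (w - p) < wedge d (x - p)"
proof -
  note gD = edgeD[OF g] and dD = edgeD[OF d]
  obtain b where b: "b > 0" "w - x = b *\<^sub>R g" using g by (auto simp: edge_def)
  have y: "y = x + c *\<^sub>R d" using assms(5) by (simp add: algebra_simps)
  have w: "w = x + b *\<^sub>R g" using b(2) by (simp add: algebra_simps)
  have "0 \<le> wedge g (y - x)" using gD(7) assms by blast
  then have "0 \<le> c * wedge g d" using y by simp
  then have ge: "wedge d g \<le> 0" using assms(4) wedge_swap[of d g] by (simp add: zero_le_mult_iff)
  have ne: "wedge d g \<noteq> 0"
  proof
    assume 0: "wedge d g = 0"
    then consider "g = d" | "g = - d" using parallel_cases dD gD by blast
    then show False
    proof cases
      case 1
      then show False using gD(7)[OF dD(2)] pos by (simp add: wedge_diff_right)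
    next
      case 2
      have "wedge d (y - x) = 0" "wedge d (w - x) = 0" using y w 0 by simp_all
      moreover have "y \<noteq> x" using y assms(4) nonzero[OF dD(1)] by simp
      ultimately have "y = w" using partner_unique[of d x y w] dD gD assms by blast
      then have "(b + c) *\<^sub>R d = 0" using y w 2 by (simp add: scaleR_left_distrib)
      then show False using b(1) assms(4) nonzero[OF dD(1)] by simp
    qed
  qed
  have "wedge d (w - p) = wedge d (x - p) + b * wedge d g"
    using w by (simp add: wedge_diff_right wedge_add_right)
  moreover have "b * wedge d g < 0" using b(1) ge ne by (simp add: mult_less_0_iff)
  ultimately show ?thesis by linarith
qed

lemma above_bottom:
  assumes "edge d p q" "z \<in> P" "z \<noteq> p" "z \<noteq> q"
  shows "0 < wedge d (z - p)"
  using edgeD(7)[OF assms(1,2)] bottom_level[OF assms(1,2)] assms(3,4) by fastforce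

lemma descent:
  assumes d: "edge d p q" and z: "z \<in> P" "z \<noteq> p" "z \<noteq> q"
  shows "\<exists>w\<in>P. (succ w = z \<or> succ z = w) \<and> wedge d w < wedge d z"
proof -
  note pos = above_bottom[OF assms]
  obtain x y c where xy: "x \<in> P" "y \<in> P" "z = x \<or> z = y" "c > 0" "y - x = c *\<^sub>R d"
    using oriented_level[OF edgeD(1)[OF d] z(1)] .
  from xy(3) show ?thesis
  proof
    assume "z = x"
    obtain g w where w: "edge g x w" using edge_from xy by blast
    have "wedge d (w - p) < wedge d (x - p)"
      by (rule succ_below[OF d xy(1,2,4,5)]) (use pos w \<open>z = x\<close> in auto)
    then show ?thesis using succ_eq[OF w] edgeD[OF w] \<open>z = x\<close> by (auto simp: wedge_diff_right)
  next
    assume "z = y"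
    obtain g w where w: "edge g w y" using edge_into xy by blast
    have "wedge d (w - p) < wedge d (y - p)"
      by (rule pred_below[OF d xy(1,2,4,5)]) (use pos w \<open>z = y\<close> in auto)
    then show ?thesis using succ_eq[OF w] edgeD[OF w] \<open>z = y\<close> by (auto simp: wedge_diff_right)
  qed
qed

text \<open>The set \<open>T\<close> stands for the lowest lines, already known.  The two points of the
  next line are adjacent on the hull to points further down, that is, to points of \<open>T\<close>.\<close>
lemma next_level:
  assumes d: "edge d p q" and T: "p \<in> T" "q \<in> T" "T \<subset> P"
    and closed: "\<And>x y. \<lbrakk>x \<in> T; y \<in> P; wedge d (y - x) = 0\<rbrakk> \<Longrightarrow> y \<in> T"
  obtains x y c where "x \<in> P - T" "y \<in> P - T" "y - x = c *\<^sub>R d" "succ x \<in> T"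
    "\<exists>w\<in>T. succ w = y"
proof -
  have "finite (P - T)" "P - T \<noteq> {}" using finite_P T by auto
  then obtain z where z: "z \<in> P - T" "\<forall>w\<in>P - T. wedge d z \<le> wedge d w"
    by (rule finite_minimizer)
  obtain x y c where xy: "x \<in> P" "y \<in> P" "z = x \<or> z = y" "c > 0" "y - x = c *\<^sub>R d"
    using oriented_level[OF edgeD(1)[OF d]] z by blast
  have "wedge d (y - x) = 0" using xy by simp
  then have "wedge d y = wedge d x" unfolding wedge_diff_right by simp
  then have lev: "wedge d (y - x) = 0" "wedge d (x - y) = 0" "wedge d x = wedge d z" "wedge d y = wedge d z"
    using xy(3) unfolding wedge_diff_right by auto
  then have nT: "x \<notin> T" "y \<notin> T" using closed xy z by blast+
  have lower: "w \<in> T" if "w \<in> P" "wedge d (w - p) < wedge d (z - p)" for w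
    using that z(2) by (force simp: wedge_diff_right)
  have pos: "0 < wedge d (x - p)" "0 < wedge d (y - p)"
    using above_bottom[OF d] xy nT T by blast+
  obtain g w where w: "edge g x w" using edge_from xy by blast
  have "w \<in> T" using succ_below[OF d xy(1,2,4,5) pos(1) w] lower edgeD[OF w] lev
    by (simp add: wedge_diff_right)
  then have s: "succ x \<in> T" using succ_eq[OF w] by simp
  obtain h u where u: "edge h u y" using edge_into xy by blast
  have "u \<in> T" using pred_below[OF d xy(1,2,4,5) pos(2) u] lower edgeD[OF u] lev
    by (simp add: wedge_diff_right)
  then have "\<exists>w\<in>T. succ w = y" using succ_eq[OF u] by blast
  then show ?thesis using that nT xy s by blast
qed


section \<open>The cyclic walk along the boundary\<close>

definition walk :: "real^2 \<Rightarrow> nat \<Rightarrow> real^2" where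
  "walk p k = (succ ^^ k) p"

lemma walk_0 [simp]: "walk p 0 = p"
  by (simp add: walk_def)

lemma walk_Suc: "walk p (Suc k) = succ (walk p k)"
  by (simp add: walk_def)

lemma walk_in: "p \<in> P \<Longrightarrow> walk p k \<in> P"
  by (induction k) (auto simp: walk_Suc succ_in)

lemma walk_add: "walk (walk p j) k = walk p (j + k)"
  by (simp add: walk_def funpow_add add.commute[of j])

lemma walk_edge: "p \<in> P \<Longrightarrow> \<exists>d. edge d (walk p k) (walk p (Suc k))"
  using edge_succ walk_in by (simp add: walk_Suc)

lemma walk_inj:
  "\<lbrakk>p \<in> P; walk p (i + k) = walk p (j + k)\<rbrakk> \<Longrightarrow> walk p i = walk p j"
  by (induction k) (auto simp: walk_Suc dest!: inj_onD[OF inj_succ] intro: walk_in)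

text \<open>The successor map is a single cycle: from a lowest point off the orbit of \<open>p\<close> one step
  along the boundary, in a suitable sense of traversal, would lead further down and thus into the
  orbit, which is closed under \<open>succ\<close> and its inverse.\<close>
lemma walk_covers:
  assumes p: "p \<in> P"
  shows "range (walk p) = P"
proof -
  define V where "V = range (walk p)"
  have V: "walk p k \<in> V" for k by (simp add: V_def)
  have sub: "V \<subseteq> P" using walk_in[OF p] by (auto simp: V_def)
  have "succ w \<in> V" if "w \<in> V" for w
  proof -
    obtain k where "w = walk p k" using \<open>w \<in> V\<close> by (auto simp: V_def)
    then show ?thesis using V[of "Suc k"] by (simp add: walk_Suc)
  qed
  then have "succ ` V \<subseteq> V" by blast
  then have surj: "succ ` V = V"
    by (intro endo_inj_surj finite_subset[OF sub finite_P] inj_on_subset[OF inj_succ sub])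
  obtain d where d: "edge d p (succ p)" using edge_succ p by blast
  have "V = P"
  proof (rule ccontr)
    assume "V \<noteq> P"
    then have "finite (P - V)" "P - V \<noteq> {}" using finite_P sub by auto
    then obtain z where z: "z \<in> P - V" "\<forall>w\<in>P - V. wedge d z \<le> wedge d w"
      by (rule finite_minimizer)
    have "z \<noteq> p" "z \<noteq> succ p" using V[of 0] V[of 1] z(1) by (auto simp: walk_Suc)
    then obtain w where w: "w \<in> P" "succ w = z \<or> succ z = w" "wedge d w < wedge d z"
      using descent[OF d] z(1) by blast
    have wV: "w \<in> V"
    proof (rule ccontr)
      assume "w \<notin> V"
      then have "wedge d z \<le> wedge d w" using z(2) w(1) by blast
      then show False using w(3) by linarith
    qed
    from w(2) show False
    proof
      assume "succ w = z"
      moreover have "succ w \<in> V" using imageI[OF wV, of succ] unfolding surj .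
      ultimately show False using z(1) by blast
    next
      assume s: "succ z = w"
      have "w \<in> succ ` V" unfolding surj by (rule wV)
      then obtain u where u: "w = succ u" "u \<in> V" by (rule imageE)
      have "u = z"
      proof (rule inj_onD[OF inj_succ])
        show "succ u = succ z" using s u(1) by simp
        show "u \<in> P" using u(2) sub by (rule rev_subsetD)
        show "z \<in> P" using z(1) by simp
      qed
      then show False using u(2) z(1) by blast
    qed
  qed
  then show ?thesis by (simp add: V_def)
qed

lemma card_le_return:
  assumes p: "p \<in> P" and n: "0 < n" "walk p n = p"
  shows "2 * m \<le> n"
proof -
  have "walk p k \<in> walk p ` {..<n}" for k
  proof (induction k)
    case 0
    show ?case by (rule image_eqI[of _ _ 0]) (use n in simp_all)
  next
    case (Suc k)
    then obtain i where i: "i < n" "walk p k = walk p i" by auto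
    then have "walk p (Suc k) = walk p (Suc i)" by (simp add: walk_Suc)
    moreover have "walk p (Suc i) \<in> walk p ` {..<n}"
    proof (cases "Suc i = n")
      case True
      then show ?thesis by (intro image_eqI[of _ _ 0]) (use n in simp_all)
    next
      case False then show ?thesis using i by simp
    qed
    ultimately show ?case by simp
  qed
  then have "range (walk p) \<subseteq> walk p ` {..<n}" by (rule image_subsetI)
  then have "P \<subseteq> walk p ` {..<n}" unfolding walk_covers[OF p] .
  then have "card P \<le> card {..<n}" by (meson finite_lessThan surj_card_le)
  then show ?thesis using card_P by simp
qed

lemma walk_period:
  assumes p: "p \<in> P"
  shows "walk p (k + 2 * m) = walk p k"
proof -
  have "\<not> inj_on (walk p) {..2 * m}"
    using card_inj_on_le[of "walk p" "{..2 * m}" P] walk_in[OF p] finite_P card_P by auto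
  then obtain i j where ij: "i < j" "j \<le> 2 * m" "walk p i = walk p j"
    unfolding inj_on_def by (auto simp: neq_iff)
  then have r: "walk p (j - i) = p" using walk_inj[OF p, of 0 i "j - i"] by simp
  then have "j - i = 2 * m" using card_le_return[OF p _ r] ij by simp
  then show ?thesis using r walk_add[of p "j - i" k] by (simp add: add.commute)
qed

text \<open>Of the two points on the bottom line, only \<open>q\<close> has its successor above this line and only
  \<open>p\<close> its predecessor; hence the next line can contain no points but \<open>r\<close> and \<open>b\<close>.  The line after it is
  found in the same way from the four points that are then known.  That \<open>m > 2\<close> ensures that both
  lines exist.\<close>
lemma chords_parallel_to_edge:
  assumes d: "edge d p q" and P: "a \<in> P" "b \<in> P" "r \<in> P" "s \<in> P"
    and succ: "succ a = b" "succ b = p" "succ q = r" "succ r = s" and "b \<noteq> r"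
  shows "wedge d (r - b) = 0" and "wedge d (s - a) = 0"
proof -
  have pq: "p \<in> P" "q \<in> P" "succ p = q" using edgeD[OF d] succ_eq[OF d] by blast+
  have inj: "x = y" if "x \<in> P" "y \<in> P" "succ x = succ y" for x y
    using inj_onD[OF inj_succ that(3,1,2)] .
  have small: "T \<subset> P" if "card T < 2 * m" "T \<subseteq> P" for T
    using that card_P by auto
  have "card {p, q} \<le> 2" using card_length[of "[p, q]"] by simp
  then have T1: "{p, q} \<subset> P" using m_gt_2 pq by (intro small) simp_all
  have closed1: "y \<in> {p, q}" if "x \<in> {p, q}" "y \<in> P" "wedge d (y - x) = 0" for x y
    using that bottom_level[OF d that(2)] edgeD(6)[OF d] by (auto simp: wedge_diff_right)
  obtain x y c where xy: "x \<in> P - {p, q}" "y \<in> P - {p, q}" "y - x = c *\<^sub>R d"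
    "succ x \<in> {p, q}" "\<exists>w\<in>{p, q}. succ w = y"
    by (rule next_level[OF d _ _ T1 closed1]) simp_all
  have "succ x \<noteq> q" using inj[of x p] xy(1) pq by auto
  then have "x = b" using xy(1,4) inj[of x b] succ P by auto
  moreover have "y = r" using xy(2,5) pq succ by auto
  ultimately show chord: "wedge d (r - b) = 0" using xy(3) by simp
  let ?T = "{b, p, q, r}"
  have "card ?T \<le> 4" using card_length[of "[b, p, q, r]"] by simp
  then have T2: "?T \<subset> P" using m_gt_2 pq P by (intro small) simp_all
  have closed2: "y \<in> ?T" if "x \<in> ?T" "y \<in> P" "wedge d (y - x) = 0" for x y
  proof (cases "x \<in> {p, q}")
    case True
    then show ?thesis using closed1[OF True that(2,3)] by blast
  next
    case False
    then have "wedge d (y - b) = 0" using that(1,3) chord by (auto simp: wedge_diff_right)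
    then have "y = b \<or> y = r"
      using partner_unique[OF edgeD(1)[OF d] P(2,3) that(2)] chord \<open>b \<noteq> r\<close> by metis
    then show ?thesis by blast
  qed
  obtain x y c where xy: "x \<in> P - ?T" "y \<in> P - ?T" "y - x = c *\<^sub>R d"
    "succ x \<in> ?T" "\<exists>w\<in>?T. succ w = y"
    by (rule next_level[OF d _ _ T2 closed2]) simp_all
  have "succ x \<noteq> p" "succ x \<noteq> q" "succ x \<noteq> r"
    using inj[of x b] inj[of x p] inj[of x q] xy(1) pq P succ by auto
  then have "x = a" using xy(1,4) inj[of x a] succ P by auto
  moreover have "y = s" using xy(2,5) pq succ by auto
  ultimately show "wedge d (s - a) = 0" using xy(3) by simp
qed

lemma walk_chords:
  assumes p: "p \<in> P" and d: "edge d (walk p (k + 2)) (walk p (k + 3))"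
  shows "wedge d (walk p (k + 4) - walk p (k + 1)) = 0"
    and "wedge d (walk p (k + 5) - walk p k) = 0"
proof -
  have s: "succ (walk p k) = walk p (k + 1)" "succ (walk p (k + 1)) = walk p (k + 2)"
    "succ (walk p (k + 3)) = walk p (k + 4)" "succ (walk p (k + 4)) = walk p (k + 5)"
    by (simp_all add: numeral_eq_Suc walk_Suc)
  have "walk p (k + 1) \<noteq> walk p (k + 4)"
    using card_le_return[OF walk_in[OF p], of 3 "k + 1"] m_gt_2
    by (auto simp: walk_add add.commute[of 4])
  then show "wedge d (walk p (k + 4) - walk p (k + 1)) = 0" "wedge d (walk p (k + 5) - walk p k) = 0"
    using chords_parallel_to_edge[OF d _ _ _ _ s] walk_in[OF p] by blast+
qed

definition side :: "real^2 \<Rightarrow> nat \<Rightarrow> real^2" where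
  "side p k = walk p (Suc k) - walk p k"

lemma side_edge:
  assumes "p \<in> P"
  obtains c d where "c > 0" "side p k = c *\<^sub>R d" "edge d (walk p k) (walk p (Suc k))"
  using walk_edge[OF assms, of k] unfolding side_def edge_def by auto

lemma sides_not_parallel:
  assumes "p \<in> P"
  shows "wedge (side p k) (side p (Suc k)) \<noteq> 0"
proof
  assume *: "wedge (side p k) (side p (Suc k)) = 0"
  obtain c d where d: "c > 0" "side p k = c *\<^sub>R d" "edge d (walk p k) (walk p (Suc k))"
    using side_edge[OF assms] .
  have "wedge d (walk p (Suc (Suc k)) - walk p (Suc k)) = 0" using * d(1,2) by (simp add: side_def)
  then have "wedge d (walk p (Suc (Suc k)) - walk p k) = 0"
    using edgeD(6)[OF d(3)] by (simp add: wedge_diff_right)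
  then consider "walk p (k + 2) = walk p k" | "walk p (k + 2) = walk p (k + 1)"
    using bottom_level[OF d(3) walk_in[OF assms]] by fastforce
  then show False
  proof cases
    case 1
    then show ?thesis using card_le_return[OF walk_in[OF assms], of 2 k] m_gt_2 by (simp add: walk_add)
  next
    case 2
    then show ?thesis using card_le_return[OF walk_in[OF assms], of 1 "k+1"] m_gt_2
      by (simp add: walk_add)
  qed
qed

text \<open>Equal side vectors have the same direction, and each direction belongs to one edge.\<close>
lemma side_determines_vertex:
  assumes p: "p \<in> P" and eq: "side p i = side p j"
  shows "walk p i = walk p j"
proof -
  obtain c d where d: "c > 0" "side p i = c *\<^sub>R d" "edge d (walk p i) (walk p (Suc i))"
    using side_edge[OF p] .
  obtain c' d' where d': "c' > 0" "side p j = c' *\<^sub>R d'" "edge d' (walk p j) (walk p (Suc j))"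
    using side_edge[OF p] .
  have "wedge (c *\<^sub>R d) (c' *\<^sub>R d') = 0" using d d' eq by (metis wedge_self)
  then have "wedge d d' = 0" using d d' by simp
  then consider "d' = d" | "d' = - d" using parallel_cases edgeD d d' by blast
  then show ?thesis
  proof cases
    case 1 then show ?thesis using edge_dir_determines d d' by blast
  next
    case 2
    have "c *\<^sub>R d = - (c' *\<^sub>R d)" using d d' eq 2 by simp
    then have "(c + c') *\<^sub>R d = 0" by (simp add: scaleR_left_distrib)
    then show ?thesis using d d' nonzero edgeD(1)[OF d(3)] by simp
  qed
qed

lemma outer_sides_parallel_to_middle:
  assumes p: "p \<in> P"
  shows "wedge (side p (Suc k)) (side p k + side p (k + 2)) = 0"
    and "wedge (side p (k + 2)) (side p k + side p (k + 4)) = 0"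
proof -
  have *: "wedge (side p (k + 2)) (side p (k + 1) + side p (k + 3)) = 0"
    "wedge (side p (k + 2)) (side p k + side p (k + 4)) = 0" if p: "p \<in> P" for p k
  proof -
    obtain c d where d: "c > 0" "side p (k + 2) = c *\<^sub>R d" "edge d (walk p (k + 2)) (walk p (k + 3))"
      using side_edge[OF p, of "k + 2"] by (auto simp: numeral_eq_Suc)
    note ch = walk_chords[OF p d(3)]
    have "wedge d (side p (k + 2)) = 0" using d by simp
    then have "wedge d (side p (k + 1) + side p (k + 3)) = 0"
      "wedge d (side p k + side p (k + 4)) = 0"
      using ch by (simp_all add: side_def wedge_diff_right wedge_add_right numeral_eq_Suc)
    then show "wedge (side p (k + 2)) (side p (k + 1) + side p (k + 3)) = 0"
      "wedge (side p (k + 2)) (side p k + side p (k + 4)) = 0" using d by simp_all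
  qed
  show "wedge (side p (k + 2)) (side p k + side p (k + 4)) = 0" using *(2)[OF p] .
  have per: "side p (j + 2 * m) = side p j" for j
    using walk_period[OF p, of j] walk_period[OF p, of "Suc j"] by (simp add: side_def)
  \<comment> \<open>The chord fact concerns indices at least 1; the index 0 is reached by going once around.\<close>
  have "k + 2 * m - 1 + 2 = Suc k + 2 * m" "k + 2 * m - 1 + 1 = k + 2 * m"
    "k + 2 * m - 1 + 3 = k + 2 + 2 * m" using m_gt_2 by simp_all
  then show "wedge (side p (Suc k)) (side p k + side p (k + 2)) = 0"
    using *(1)[OF p, of "k + 2 * m - 1"] per by metis
qed

end

section \<open>Periodic three-term recurrences\<close>

text \<open>The sequence is bounded, and comparing the terms around one of maximal absolute value
  gives \<open>\<bar>\<tau>\<bar> \<le> 2\<close>.  If \<open>\<tau> = p / q\<close> in lowest terms, then \<open>q\<close> divides every term, and the quotients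
  satisfy the same recurrence; so all powers of \<open>q\<close> divide every term, and \<open>q = 1\<close>.\<close>
lemma integer_recurrence:
  fixes a :: "nat \<Rightarrow> int" and \<tau> :: real
  assumes rec: "\<And>k. real_of_int (a k) + a (k + 2) = \<tau> * a (k + 1)"
    and per: "\<And>k. a (k + m) = a k" and m: "0 < m" and nz: "a 0 \<noteq> 0"
  shows "\<tau> \<in> {-2, -1, 0, 1, 2}"
proof -
  define M where "M = Max ((\<lambda>k. \<bar>a k\<bar>) ` {..<m})"
  have per': "a (k + i * m) = a k" for k i
  proof (induction i)
    case (Suc i)
    then show ?case using per[of "k + i * m"] by (simp add: algebra_simps)
  qed simp
  have mod: "a k = a (k mod m)" for k
    using per'[of "k mod m" "k div m"] by simp
  have fin: "finite ((\<lambda>k. \<bar>a k\<bar>) ` {..<m})" "(\<lambda>k. \<bar>a k\<bar>) ` {..<m} \<noteq> {}" using m by auto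
  have M: "\<bar>a k\<bar> \<le> M" for k
    unfolding M_def by (subst mod, rule Max_ge[OF fin(1)]) (use m in auto)
  obtain j where j: "\<bar>a j\<bar> = M" using Max_in[OF fin] unfolding M_def by auto
  have Mpos: "M > 0" using M[of 0] nz by linarith
  \<comment> \<open>The period is added so that the maximal term has a predecessor.\<close>
  define k where "k = j + m - 1"
  have "k + 1 = j + m" using m by (simp add: k_def)
  then have k: "\<bar>a (k + 1)\<bar> = M" using j per[of j] by simp
  have "\<bar>\<tau>\<bar> * M = \<bar>real_of_int (a k) + a (k + 2)\<bar>"
    unfolding rec abs_mult using k by (metis of_int_abs)
  also have "\<dots> \<le> 2 * M" using M[of k] M[of "k + 2"] by linarith
  finally have bound: "\<bar>\<tau>\<bar> \<le> 2" using Mpos by simp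
  have "a (k + 1) \<noteq> 0" using k Mpos by linarith
  then have "\<tau> = real_of_int (a k + a (k + 2)) / a (k + 1)"
    using rec[of k] by (simp only: of_int_add eq_divide_eq of_int_eq_0_iff) simp
  then have "\<tau> \<in> \<rat>" by simp
  then obtain p q where pq: "\<tau> = of_int p / of_int q" "q > 0" "coprime p q"
    by (metis Rats_cases')
  have div: "\<forall>k. q ^ n dvd b k"
    if "\<And>k. real_of_int (b k) + b (k + 2) = \<tau> * b (k + 1)" "\<And>k. b (k + m) = b k"
    for n and b :: "nat \<Rightarrow> int"
    using that
  proof (induction n arbitrary: b)
    case 0 show ?case by simp
  next
    case (Suc n)
    have "q dvd b (k + 1)" for k
    proof -
      have "real_of_int (q * (b k + b (k + 2))) = real_of_int (p * b (k + 1))"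
        using Suc.prems(1)[of k] pq by (simp add: field_simps)
      then have "q * (b k + b (k + 2)) = p * b (k + 1)" using of_int_eq_iff by blast
      then have "q dvd p * b (k + 1)" by (metis dvd_triv_left)
      then show ?thesis using pq(3) by (simp add: coprime_commute coprime_dvd_mult_right_iff)
    qed
    then have q: "q dvd b k" for k using Suc.prems(2)[of k] m
      by (metis Suc_eq_plus1 add_Suc_right gr0_implies_Suc)
    define c where "c k = b k div q" for k
    have bc: "b k = q * c k" for k using q by (simp add: c_def)
    have "q ^ n dvd c k" for k
    proof (rule Suc.IH[rule_format])
      show "real_of_int (c k) + c (k + 2) = \<tau> * c (k + 1)" for k
      proof -
        have "real_of_int q * (real_of_int (c k) + c (k + 2)) = q * (\<tau> * c (k + 1))"
          using Suc.prems(1)[of k] by (simp add: bc algebra_simps)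
        then show ?thesis using pq(2) by simp
      qed
      show "c (k + m) = c k" for k using Suc.prems(2) by (simp add: c_def)
    qed
    then show ?case using bc pq(2) by simp
  qed
  have "q = 1"
  proof (rule ccontr)
    assume "q \<noteq> 1"
    then have "2 \<le> q" using pq(2) by simp
    have "q ^ nat \<bar>a 0\<bar> dvd a 0" using div[OF rec per] by blast
    then have "q ^ nat \<bar>a 0\<bar> \<le> \<bar>a 0\<bar>" by (rule order_trans[OF abs_ge_self dvd_imp_le_int[OF nz]])
    moreover have "(2::int) ^ nat \<bar>a 0\<bar> \<le> q ^ nat \<bar>a 0\<bar>" using \<open>2 \<le> q\<close> by (intro power_mono) auto
    moreover have "\<bar>a 0\<bar> < 2 ^ nat \<bar>a 0\<bar>"
    proof -
      have "int (nat \<bar>a 0\<bar>) < int (2 ^ nat \<bar>a 0\<bar>)" by (simp only: of_nat_less_iff less_exp)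
      then show ?thesis by simp
    qed
    ultimately show False by linarith
  qed
  then have "\<tau> = of_int p" using pq by simp
  moreover from this have "p \<in> {-2, -1, 0, 1, 2}" using bound by auto
  ultimately show ?thesis by auto
qed

text \<open>An arithmetic progression that returns to its first term is constant.\<close>
lemma second_difference_zero_periodic:
  fixes u :: "nat \<Rightarrow> 'a::real_vector"
  assumes rec: "\<And>k. u k + u (k + 2) = 2 *\<^sub>R u (k + 1)"
    and per: "u n = u 0" and n: "0 < n"
  shows "u 1 = u 0"
proof -
  have step: "u (Suc k) - u k = u 1 - u 0" for k
  proof (induction k)
    case (Suc k)
    have "u (Suc (Suc k)) - u (Suc k) = u (Suc k) - u k"
      using rec[of k] by (simp add: scaleR_2 algebra_simps)
    then show ?case using Suc by simp
  qed simp
  have "u k = u 0 + real k *\<^sub>R (u 1 - u 0)" for k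
  proof (induction k)
    case (Suc k)
    have "u (Suc k) = u k + (u 1 - u 0)" using step[of k] by (simp add: algebra_simps)
    also have "\<dots> = u 0 + real (Suc k) *\<^sub>R (u 1 - u 0)"
      unfolding Suc by (simp add: scaleR_left_distrib)
    finally show ?case .
  qed simp
  from this[of n] show ?thesis using per n by simp
qed

text \<open>For \<open>\<tau> = -1, 0, 1\<close> the recurrence alone has the period 3, 4, 6.  For \<open>\<tau> = 2\<close> the
  sequence is an arithmetic progression and for \<open>\<tau> = -2\<close> it becomes one after alternating the signs,
  so that here the assumed periodicity has to be used.\<close>
lemma recurrence_returns:
  fixes w :: "nat \<Rightarrow> 'a::real_vector"
  assumes rec: "\<And>k. w k + w (k + 2) = \<tau> *\<^sub>R w (k + 1)"
    and per: "\<And>k. w (k + m) = w k" and m: "0 < m"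
    and \<tau>: "\<tau> \<in> {-2, -1, 0, 1, 2}"
  shows "\<exists>n\<in>{1, 2, 3, 4, 6}. w n = w 0"
proof -
  have next_w: "w (Suc (Suc k)) = \<tau> *\<^sub>R w (Suc k) - w k" for k
    using rec[of k] by (simp add: algebra_simps)
  from \<tau> consider "\<tau> = -2" | "\<tau> = -1" | "\<tau> = 0" | "\<tau> = 1" | "\<tau> = 2" by blast
  then show ?thesis
  proof cases
    case 1
    define u where "u k = (-1) ^ k *\<^sub>R w k" for k
    have "u k + u (k + 2) = 2 *\<^sub>R u (k + 1)" for k
    proof -
      have "u k + u (k + 2) = (-1) ^ k *\<^sub>R (w k + w (k + 2))"
        by (simp add: u_def scaleR_right_distrib)
      also have "\<dots> = 2 *\<^sub>R u (k + 1)" unfolding rec 1 by (simp add: u_def mult.commute)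
      finally show ?thesis .
    qed
    moreover have "u (m + m) = u 0"
      using per[of m] per[of 0] by (simp add: u_def flip: power2_eq_square mult_2)
    ultimately have "u 1 = u 0" using m second_difference_zero_periodic[of u "m + m"] by simp
    then have "w 1 = - w 0" by (simp add: u_def minus_equation_iff)
    then have "w 2 = w 0" using next_w[of 0] 1 by (simp add: numeral_2_eq_2 scaleR_2)
    then show ?thesis by blast
  next
    case 2
    then have "w 3 = w 0" using next_w[of 0] next_w[of 1] by (simp add: numeral_eq_Suc)
    then show ?thesis by blast
  next
    case 3
    then have "w 4 = w 0" using next_w[of 0] next_w[of 2] by (simp add: numeral_eq_Suc)
    then show ?thesis by blast
  next
    case 4
    have "w (k + 3) = - w k" for k
      using next_w[of k] next_w[of "Suc k"] 4 by (simp add: numeral_eq_Suc)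
    from this[of 0] this[of 3] have "w 6 = w 0" by simp
    then show ?thesis by blast
  next
    case 5
    have "w 1 = w 0" using second_difference_zero_periodic[OF rec[unfolded 5], of m] per[of 0] m
      by simp
    then show ?thesis by blast
  qed
qed

text \<open>The assumption \<open>near\<close> gives \<open>e k + e (k + 2) = t k *\<^sub>R e (k + 1)\<close>, whence consecutive wedges
  are equal.  Wedging \<open>e (k + 2)\<close> with \<open>e k + e (k + 4)\<close> then turns \<open>far\<close> into \<open>t k = t (k + 2)\<close>.
  Eliminating the vectors of the other parity leaves the constant \<open>t 0 * t 1 - 2\<close>.\<close>
lemma three_term_recurrence_of_sides:
  fixes e :: "nat \<Rightarrow> real^2"
  assumes indep: "\<And>k. wedge (e k) (e (Suc k)) \<noteq> 0"
    and near: "\<And>k. wedge (e (Suc k)) (e k + e (k + 2)) = 0"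
    and far: "\<And>k. wedge (e (k + 2)) (e k + e (k + 4)) = 0"
  obtains \<tau> where "\<And>k. e k + e (k + 4) = \<tau> *\<^sub>R e (k + 2)"
proof -
  have nz: "e k \<noteq> 0" for k using indep[of k] by (auto simp: wedge_def)
  have "\<exists>c. e k + e (k + 2) = c *\<^sub>R e (Suc k)" for k
    using parallel_if_wedge_eq_0[OF nz near] by metis
  then obtain t where t: "\<And>k. e k + e (k + 2) = t k *\<^sub>R e (Suc k)" by metis
  have e2: "e (Suc (Suc k)) = t k *\<^sub>R e (Suc k) - e k" for k
    using t[of k] by (simp add: algebra_simps)
  have e4: "e (k + 4) = t (k + 2) *\<^sub>R e (k + 3) - e (k + 2)" for k
    using e2[of "k + 2"] by (simp add: numeral_eq_Suc)
  have e0: "e k = t k *\<^sub>R e (k + 1) - e (k + 2)" for k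
    using t[of k] by (simp add: algebra_simps)
  have e3: "e (k + 3) = t (k + 1) *\<^sub>R e (k + 2) - e (k + 1)" for k
    using e2[of "k + 1"] by (simp add: numeral_eq_Suc)
  have t2: "t (k + 2) = t k" for k
  proof -
    have w1: "wedge (e (k + 2)) (e (k + 3)) = - wedge (e (k + 2)) (e (k + 1))"
      unfolding e3 by (simp add: wedge_diff_right)
    have "0 = wedge (e (k + 2)) (e k) + wedge (e (k + 2)) (e (k + 4))"
      using far[of k] by (simp add: wedge_add_right)
    also have "wedge (e (k + 2)) (e k) = t k * wedge (e (k + 2)) (e (k + 1))"
      by (subst e0) (simp add: wedge_diff_right)
    also have "wedge (e (k + 2)) (e (k + 4)) = t (k + 2) * wedge (e (k + 2)) (e (k + 3))"
      unfolding e4 by (simp add: wedge_diff_right)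
    finally have "(t k - t (k + 2)) * wedge (e (k + 2)) (e (k + 1)) = 0"
      unfolding w1 by (auto simp: algebra_simps)
    then show ?thesis using indep[of "k + 1"] wedge_swap[of "e (k + 1)" "e (k + 2)"] by auto
  qed
  have const: "t k * t (Suc k) = t 0 * t 1" for k
  proof (induction k)
    case (Suc k)
    then show ?case using t2[of k] by (simp add: mult.commute)
  qed simp
  have "e k + e (k + 4) = (t 0 * t 1 - 2) *\<^sub>R e (k + 2)" for k
  proof -
    have "e k + e (k + 4) = t k *\<^sub>R (e (k + 1) + e (k + 3)) - 2 *\<^sub>R e (k + 2)"
      unfolding e4 t2 by (subst e0) (simp add: scaleR_2 algebra_simps)
    also have "e (k + 1) + e (k + 3) = t (Suc k) *\<^sub>R e (k + 2)"
      unfolding e3 by simp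
    finally show ?thesis unfolding const[of k, symmetric] by (simp add: algebra_simps)
  qed
  then show ?thesis by (rule that)
qed

section \<open>The order of a lattice configuration\<close>

context matched_configuration
begin

lemma return_dvd:
  assumes p: "p \<in> P" and "walk p n = p"
  shows "2 * m dvd n"
proof -
  have per: "walk p (k + i * (2 * m)) = walk p k" for k i
  proof (induction i)
    case (Suc i)
    then show ?case using walk_period[OF p, of "k + i * (2 * m)"] by (simp add: algebra_simps)
  qed simp
  have "walk p n = walk p (n mod (2 * m))"
    using per[of "n mod (2 * m)" "n div (2 * m)"] unfolding mod_div_mult_eq .
  moreover have "n mod (2 * m) < 2 * m" using m_gt_2 by simp
  ultimately have "n mod (2 * m) = 0"
    using card_le_return[OF p, of "n mod (2 * m)"] assms(2) by fastforce
  then show ?thesis by (simp add: dvd_eq_mod_eq_0)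
qed

lemma lattice_configuration_order:
  assumes lattice: "P \<subseteq> integer_lattice"
  shows "m \<in> {3, 4, 6}"
proof -
  have "P \<noteq> {}" using card_P m_gt_2 by auto
  then obtain p where p: "p \<in> P" by blast
  obtain \<tau> where \<tau>: "\<And>k. side p k + side p (k + 4) = \<tau> *\<^sub>R side p (k + 2)"
    using three_term_recurrence_of_sides[OF sides_not_parallel[OF p]
        outer_sides_parallel_to_middle[OF p]] by blast
  define w where "w k = side p (2 * k)" for k
  have rec: "w k + w (k + 2) = \<tau> *\<^sub>R w (k + 1)" for k
  proof -
    have idx: "2 * (k + 2) = 2 * k + 4" "2 * (k + 1) = 2 * k + 2" by simp_all
    show ?thesis unfolding w_def idx by (rule \<tau>)
  qed
  have per: "w (k + m) = w k" for k
    using walk_period[OF p, of "2 * k"] walk_period[OF p, of "Suc (2 * k)"]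
    by (simp add: w_def side_def algebra_simps)
  have "w 0 \<noteq> 0" using sides_not_parallel[OF p, of 0] by (auto simp: w_def wedge_def)
  then obtain i where i: "w 0 $ i \<noteq> 0" by (auto simp: vec_eq_iff)
  have "w k $ i \<in> \<int>" for k
    using walk_in[OF p] lattice by (auto simp: w_def side_def integer_lattice_def intro!: Ints_diff)
  then have "\<exists>a. w k $ i = of_int a" for k by (metis Ints_cases)
  then obtain a where a: "\<And>k. w k $ i = of_int (a k)" by metis
  have "\<tau> \<in> {-2, -1, 0, 1, 2}"
  proof (rule integer_recurrence)
    show "real_of_int (a k) + a (k + 2) = \<tau> * a (k + 1)" for k
      using arg_cong[OF rec[of k], of "\<lambda>x. x $ i"] by (simp add: a)
    show "a (k + m) = a k" for k using per[of k] a by (metis of_int_eq_iff)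
    show "a 0 \<noteq> 0" using i a[of 0] by simp
    show "0 < m" using m_gt_2 by simp
  qed
  then obtain n where n: "n \<in> {1, 2, 3, 4, 6}" "w n = w 0"
    using recurrence_returns[OF rec per] m_gt_2 by auto
  then have "walk p (2 * n) = p"
    using side_determines_vertex[OF p, of "2 * n" 0] by (simp add: w_def)
  then have "m dvd n" using return_dvd[OF p] by fastforce
  then have "m \<le> n" using n(1) by (auto dest: dvd_imp_le)
  then have "m = 3 \<or> m = 4 \<or> m = 5 \<or> m = 6" using n(1) m_gt_2 by auto
  then show ?thesis using n(1) \<open>m dvd n\<close> by auto
qed

end

section \<open>Extremal switching components\<close>

lemma mem_line_iff:
  assumes "d \<noteq> 0"
  shows "q \<in> {p + t *\<^sub>R d | t. t \<in> UNIV} \<longleftrightarrow> wedge d (q - p) = 0"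
proof
  assume "wedge d (q - p) = 0"
  then obtain c where "q - p = c *\<^sub>R d" using parallel_if_wedge_eq_0[OF assms] by metis
  then have "q = p + c *\<^sub>R d" by (simp add: algebra_simps)
  then show "q \<in> {p + t *\<^sub>R d | t. t \<in> UNIV}" by blast
qed auto

lemma xray_eqD:
  assumes "xray d F = xray d G" "d \<noteq> 0"
  shows "card {q\<in>F. wedge d (q - p) = 0} = card {q\<in>G. wedge d (q - p) = 0}"
proof -
  let ?L = "{p + t *\<^sub>R d | t. t \<in> UNIV}"
  have "?L \<in> parallel_lines d" unfolding parallel_lines_def by blast
  then have "card (F \<inter> ?L) = card (G \<inter> ?L)"
    using fun_cong[OF assms(1), of ?L] by (simp add: xray_def)
  moreover have "H \<inter> ?L = {q\<in>H. wedge d (q - p) = 0}" for H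
    using mem_line_iff[OF assms(2)] by blast
  ultimately show ?thesis by simp
qed

lemma wedge_eq_0_trans:
  assumes "wedge a u = 0" "wedge b u = 0" "u \<noteq> 0"
  shows "wedge a b = 0"
proof -
  have "wedge u a = 0" "wedge u b = 0" using assms wedge_swap by (metis neg_equal_0_iff_equal)+
  then obtain x y where "a = x *\<^sub>R u" "b = y *\<^sub>R u"
    using parallel_if_wedge_eq_0[OF assms(3)] by metis
  then show ?thesis by simp
qed

lemma independent_imp_wedge:
  assumes "independent {a, b}" "a \<noteq> b"
  shows "wedge a b \<noteq> 0"
proof
  assume w: "wedge a b = 0"
  have "a \<noteq> 0" using assms(1) dependent_zero by blast
  then obtain c where "b = c *\<^sub>R a" using parallel_if_wedge_eq_0[OF _ w] by metis
  then have "b \<in> span {a}" by (simp add: span_base span_scale)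
  moreover have "independent (insert b {a})" using assms(1) by (simp add: insert_commute)
  ultimately show False using assms(2) by (simp add: independent_insert)
qed

lemma partner_in_other_set:
  assumes fin: "finite F" "finite G" and p: "p \<in> F - G"
    and eq: "card {q\<in>F. wedge d (q - p) = 0} = card {q\<in>G. wedge d (q - p) = 0}"
  shows "\<exists>q\<in>G - F. wedge d (q - p) = 0"
proof (rule ccontr)
  assume "\<not> ?thesis"
  then have "{q\<in>G. wedge d (q - p) = 0} \<subset> {q\<in>F. wedge d (q - p) = 0}" using p by auto
  then have "card {q\<in>G. wedge d (q - p) = 0} < card {q\<in>F. wedge d (q - p) = 0}"
    using fin by (intro psubset_card_mono) auto
  then show False using eq by simp
qed

text \<open>The partners of \<open>p\<close> in the \<open>m\<close> directions are \<open>m\<close> distinct points of \<open>G - F\<close>, so they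
  exhaust \<open>G\<close>.\<close>
lemma few_points_force_unique_partners:
  fixes s :: "nat \<Rightarrow> real^2"
  assumes fin: "finite F" "finite G" and p: "p \<in> F - G" and small: "card G \<le> m"
    and indep: "\<And>i j. \<lbrakk>i \<in> {1..m}; j \<in> {1..m}; i \<noteq> j\<rbrakk> \<Longrightarrow> wedge (s i) (s j) \<noteq> 0"
    and eq: "\<And>i. i \<in> {1..m} \<Longrightarrow>
      card {q\<in>F. wedge (s i) (q - p) = 0} = card {q\<in>G. wedge (s i) (q - p) = 0}"
  shows "F \<inter> G = {}" "card G = m"
    "i \<in> {1..m} \<Longrightarrow> \<exists>!q. q \<in> G \<and> wedge (s i) (q - p) = 0"
proof -
  have "\<exists>q\<in>G - F. wedge (s i) (q - p) = 0" if "i \<in> {1..m}" for i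
    using partner_in_other_set[OF fin p eq[OF that]] .
  then obtain f where f: "\<And>i. i \<in> {1..m} \<Longrightarrow> f i \<in> G - F \<and> wedge (s i) (f i - p) = 0"
    by metis
  have same: "i = j"
    if "i \<in> {1..m}" "j \<in> {1..m}" "wedge (s i) (f j - p) = 0" for i j
  proof (rule ccontr)
    assume "i \<noteq> j"
    have "f j - p \<noteq> 0" using f[OF that(2)] p by auto
    then show False using wedge_eq_0_trans[OF that(3)] f[OF that(2)] indep[OF that(1,2) \<open>i \<noteq> j\<close>]
      by blast
  qed
  have "inj_on f {1..m}"
  proof (rule inj_onI)
    fix i j assume ij: "i \<in> {1..m}" "j \<in> {1..m}" "f i = f j"
    then show "i = j" using same[OF ij(1,2)] f[OF ij(1)] by simp
  qed
  then have c: "card (f ` {1..m}) = m" by (simp add: card_image)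
  have sub: "f ` {1..m} \<subseteq> G - F" using f by blast
  have "m \<le> card (G - F)" using card_mono[OF _ sub] fin c by simp
  moreover have le: "card (G - F) \<le> card G" using fin by (intro card_mono) auto
  ultimately show cG: "card G = m" using small by simp
  have "G - F = G" using \<open>m \<le> card (G - F)\<close> le cG fin by (intro card_subset_eq) auto
  then show "F \<inter> G = {}" by blast
  have img: "f ` {1..m} = G" using sub fin c cG by (intro card_subset_eq) auto
  show "\<exists>!q. q \<in> G \<and> wedge (s i) (q - p) = 0" if i: "i \<in> {1..m}"
  proof (rule ex1I[of _ "f i"])
    show "f i \<in> G \<and> wedge (s i) (f i - p) = 0" using f[OF i] by blast
    fix q assume q: "q \<in> G \<and> wedge (s i) (q - p) = 0"
    then obtain j where "j \<in> {1..m}" "q = f j" using img by blast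
    then show "q = f i" using same[OF i] q by blast
  qed
qed

lemma matched_configuration_of_xrays:
  assumes adm: "admissible_directions m s" and m: "2 < m"
    and fin: "finite F" "finite G" and card: "card F = card G" "card G \<le> m" and "F \<noteq> G"
    and xray: "\<And>i. i \<in> {1..m} \<Longrightarrow> xray (s i) F = xray (s i) G"
  shows "matched_configuration (F \<union> G) (s ` {1..m} \<union> uminus ` s ` {1..m}) m"
proof -
  let ?D = "s ` {1..m}"
  have nz: "s i \<noteq> 0" if "i \<in> {1..m}" for i using adm that by (simp add: admissible_directions_def)
  have indep: "wedge (s i) (s j) \<noteq> 0" if "i \<in> {1..m}" "j \<in> {1..m}" "i \<noteq> j" for i j
    using adm that by (intro independent_imp_wedge) (auto simp: admissible_directions_def)
  have eq: "card {q\<in>F. wedge (s i) (q - p) = 0} = card {q\<in>G. wedge (s i) (q - p) = 0}"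
    if "i \<in> {1..m}" for i p using xray_eqD[OF xray nz] that by blast
  have "\<not> F \<subseteq> G" using card_subset_eq[OF fin(2)] card(1) \<open>F \<noteq> G\<close> by blast
  then obtain p0 where p0: "p0 \<in> F - G" by blast
  note F = few_points_force_unique_partners[where s = s, OF fin _ card(2) indep eq]
  have disj: "F \<inter> G = {}" and cG: "card G = m" using F(1,2)[OF p0] by blast+
  have cF: "card F \<le> m" using card by simp
  note G = few_points_force_unique_partners[where s = s, OF fin(2,1) _ cF indep eq[symmetric]]
  have FG: "\<exists>!q. q \<in> G \<and> wedge (s i) (q - p) = 0" if "i \<in> {1..m}" "p \<in> F" for i p
    using F(3)[of p i] that disj by blast
  have GF: "\<exists>!q. q \<in> F \<and> wedge (s i) (q - p) = 0" if "i \<in> {1..m}" "p \<in> G" for i p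
    using G(3)[of p i] that disj by blast
  \<comment> \<open>A second point \<open>q \<in> A\<close> on the line through \<open>p\<close> and its partner \<open>r \<in> B\<close> would give \<open>r\<close> two partners.\<close>
  have partner: "\<exists>!q. q \<in> A \<union> B \<and> q \<noteq> p \<and> wedge d (q - p) = 0"
    if p: "p \<in> A" "A \<inter> B = {}" and ex: "\<exists>!q. q \<in> B \<and> wedge d (q - p) = 0"
      and B: "\<And>r. r \<in> B \<Longrightarrow> \<exists>!q. q \<in> A \<and> wedge d (q - r) = 0" for A B p d
  proof -
    obtain r where r: "r \<in> B" "wedge d (r - p) = 0" using ex by blast
    have "q = r" if q: "q \<in> A \<union> B" "q \<noteq> p" "wedge d (q - p) = 0" for q
    proof (cases "q \<in> B")
      case True then show ?thesis using ex q r by blast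
    next
      case False
      have "wedge d (q - r) = 0" "wedge d (p - r) = 0"
        using q(3) r(2) by (simp_all add: wedge_diff_right)
      then show ?thesis using B[OF r(1)] False q p by blast
    qed
    moreover have "r \<noteq> p" using r p by blast
    ultimately show ?thesis using r by blast
  qed
  have main: "\<exists>!q. q \<in> F \<union> G \<and> q \<noteq> p \<and> wedge (s i) (q - p) = 0"
    if i: "i \<in> {1..m}" and p: "p \<in> F \<union> G" for i p
  proof (cases "p \<in> F")
    case True
    show ?thesis by (rule partner[OF True disj FG[OF i True] GF[OF i]])
  next
    case False
    then have pG: "p \<in> G" using p by blast
    have "G \<inter> F = {}" using disj by blast
    then show ?thesis using partner[OF pG _ GF[OF i pG] FG[OF i]] by (simp add: Un_commute)
  qed
  have inj: "inj_on s {1..m}"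
    using indep by (metis inj_onI wedge_self)
  then have "card ?D = m" by (simp add: card_image)
  moreover have "card (uminus ` ?D) = card ?D" by (intro card_image) simp
  moreover have "?D \<inter> uminus ` ?D = {}"
  proof (rule ccontr)
    assume "\<not> ?thesis"
    then obtain x where "x \<in> ?D" "x \<in> uminus ` ?D" by blast
    then obtain i j where ij: "i \<in> {1..m}" "j \<in> {1..m}" "s i = - s j" by blast
    then have "wedge (s i) (s j) = 0" by simp
    then have "i = j" using indep ij by blast
    then have "2 *\<^sub>R s i = 0" using ij(3) unfolding scaleR_2 eq_neg_iff_add_eq_0 by simp
    then show False using nz[OF ij(1)] by simp
  qed
  ultimately have cS: "card (?D \<union> uminus ` ?D) = 2 * m" by (subst card_Un_disjoint) auto
  have cP: "card (F \<union> G) = 2 * m" using fin disj card cG by (simp add: card_Un_disjoint)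
  have signed: "\<exists>i\<in>{1..m}. d = s i \<or> d = - s i" if "d \<in> ?D \<union> uminus ` ?D" for d
    using that by blast
  have nzS: "d \<noteq> 0" if "d \<in> ?D \<union> uminus ` ?D" for d
    using signed[OF that] nz by fastforce
  have neg: "- d \<in> ?D \<union> uminus ` ?D" if "d \<in> ?D \<union> uminus ` ?D" for d
    using that by auto
  have par: "d' = d \<or> d' = - d"
    if dd: "d \<in> ?D \<union> uminus ` ?D" "d' \<in> ?D \<union> uminus ` ?D" "wedge d d' = 0" for d d'
  proof -
    obtain i where i: "i \<in> {1..m}" "d = s i \<or> d = - s i" using signed[OF dd(1)] by blast
    obtain j where j: "j \<in> {1..m}" "d' = s j \<or> d' = - s j" using signed[OF dd(2)] by blast
    have "wedge (s i) (s j) = 0" using i(2) j(2) dd(3) by auto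
    then have "i = j" using indep[OF i(1) j(1)] by blast
    then show ?thesis using i(2) j(2) by auto
  qed
  have part: "\<exists>!q. q \<in> F \<union> G \<and> q \<noteq> p \<and> wedge d (q - p) = 0"
    if d: "d \<in> ?D \<union> uminus ` ?D" and p: "p \<in> F \<union> G" for d p
  proof -
    obtain i where i: "i \<in> {1..m}" "d = s i \<or> d = - s i" using signed[OF d] by blast
    then have "wedge d x = 0 \<longleftrightarrow> wedge (s i) x = 0" for x by auto
    then show ?thesis using main[OF i(1) p] by simp
  qed
  show ?thesis
    by (rule matched_configuration.intro[OF _ cP cS m nzS neg par part]) (use fin in simp)
qed

section \<open>Existence of switching components\<close>

lemma card_translate_inter:
  fixes t :: "real^2"
  shows "card ((+) t ` G \<inter> L) = card (G \<inter> (+) (- t) ` L)"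
proof -
  have "(+) t ` G \<inter> L = (+) t ` (G \<inter> (+) (- t) ` L)" by (auto simp: image_iff) force+
  then show ?thesis by (simp add: card_image)
qed

lemma translate_parallel_line:
  assumes "L \<in> parallel_lines d"
  shows "(+) u ` L \<in> parallel_lines d"
proof -
  obtain p where L: "L = {p + t *\<^sub>R d | t. t \<in> UNIV}" using assms by (auto simp: parallel_lines_def)
  have "(+) u ` L = {(u + p) + t *\<^sub>R d | t. t \<in> UNIV}"
    unfolding L by (auto simp: image_iff add.assoc) 
  then show ?thesis unfolding parallel_lines_def by blast
qed

lemma translate_along_parallel_line:
  assumes "L \<in> parallel_lines d"
  shows "(+) (c *\<^sub>R d) ` L = L"
proof -
  obtain p where L: "L = {p + t *\<^sub>R d | t. t \<in> UNIV}" using assms by (auto simp: parallel_lines_def)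
  show ?thesis
  proof (intro subset_antisym subsetI)
    fix x assume "x \<in> (+) (c *\<^sub>R d) ` L"
    then obtain t where "x = c *\<^sub>R d + (p + t *\<^sub>R d)" unfolding L by blast
    then have "x = p + (t + c) *\<^sub>R d" by (simp add: algebra_simps)
    then show "x \<in> L" unfolding L by blast
  next
    fix x assume "x \<in> L"
    then obtain t where "x = p + t *\<^sub>R d" unfolding L by blast
    then have "x = c *\<^sub>R d + (p + (t - c) *\<^sub>R d)" by (simp add: algebra_simps)
    moreover have "p + (t - c) *\<^sub>R d \<in> L" unfolding L by blast
    ultimately show "x \<in> (+) (c *\<^sub>R d) ` L" by (rule image_eqI)
  qed
qed

lemma xray_eqI:
  "(\<And>L. L \<in> parallel_lines d \<Longrightarrow> card (F \<inter> L) = card (G \<inter> L)) \<Longrightarrow> xray d F = xray d G"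
  unfolding xray_def by (rule restrict_ext)

lemma xray_eq_lineD:
  "\<lbrakk>xray d F = xray d G; L \<in> parallel_lines d\<rbrakk> \<Longrightarrow> card (F \<inter> L) = card (G \<inter> L)"
  unfolding xray_def by (metis restrict_apply')

text \<open>A pair for one more direction \<open>d\<close> is obtained from \<open>F\<close>, \<open>G\<close> as \<open>F \<union> (t + G)\<close>,
  \<open>G \<union> (t + F)\<close> with a translation \<open>t\<close> along \<open>d\<close> so long that the parts do not overlap.  Lines
  parallel to \<open>d\<close> are invariant under \<open>t\<close>, hence see \<open>F\<close> and \<open>G\<close> once each in both sets; in the
  old directions the parts have equal X-rays.\<close>
lemma switching_component_exists:
  fixes s :: "nat \<Rightarrow> real^2"
  assumes lat: "\<And>i. s i \<in> integer_lattice" and one: "\<And>i. s i $ 1 = 1"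
  shows "\<exists>F G. F \<subseteq> integer_lattice \<and> G \<subseteq> integer_lattice \<and> finite F \<and> finite G \<and>
    card F = card G \<and> F \<noteq> G \<and> (\<forall>i\<in>{1..k}. xray (s i) F = xray (s i) G)"
proof (induction k)
  case 0
  have "{0} \<subseteq> integer_lattice" "{s 0} \<subseteq> integer_lattice" using lat by (auto simp: integer_lattice_def)
  moreover have "{0} \<noteq> {s 0}" using one[of 0] by auto
  ultimately show ?case by (intro exI[of _ "{0}"] exI[of _ "{s 0}"]) auto
next
  case (Suc k)
  then obtain F G where FG: "F \<subseteq> integer_lattice" "G \<subseteq> integer_lattice" "finite F" "finite G"
    "card F = card G" "F \<noteq> G" "\<And>i. i \<in> {1..k} \<Longrightarrow> xray (s i) F = xray (s i) G" by blast
  let ?H = "F \<union> G" and ?d = "s (Suc k)"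
  obtain b where b: "\<And>x. x \<in> ?H \<Longrightarrow> norm x \<le> b"
    using finite_imp_bounded[of ?H] FG(3,4) unfolding bounded_iff by auto
  obtain n :: nat where n: "2 * b < real n" using reals_Archimedean2 by blast
  \<comment> \<open>The first coordinate of \<open>t\<close> exceeds all differences of first coordinates in \<open>F \<union> G\<close>.\<close>
  define t where "t = real n *\<^sub>R ?d"
  have t1: "t $ 1 = real n" using one by (simp add: t_def)
  have disj: "?H \<inter> (+) t ` ?H = {}"
  proof (rule ccontr)
    assume "\<not> ?thesis"
    then obtain x y where xy: "x \<in> ?H" "y \<in> ?H" "x = t + y" by auto
    then have "real n = x $ 1 - y $ 1" using t1 by simp
    also have "\<dots> \<le> norm x + norm y"
      using component_le_norm_cart[of x 1] component_le_norm_cart[of y 1] by linarith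
    also have "\<dots> \<le> 2 * b" using b[OF xy(1)] b[OF xy(2)] by linarith
    finally show False using n by simp
  qed
  have "t \<in> integer_lattice" using lat[of "Suc k"] by (auto simp: t_def integer_lattice_def)
  then have tl: "(+) t ` A \<subseteq> integer_lattice" if "A \<subseteq> integer_lattice" for A
    using that by (auto simp: integer_lattice_def)
  let ?F = "F \<union> (+) t ` G" and ?G = "G \<union> (+) t ` F"
  have card_Un: "card ((A \<union> (+) t ` B) \<inter> L) = card (A \<inter> L) + card (B \<inter> (+) (- t) ` L)"
    if "A \<subseteq> ?H" "B \<subseteq> ?H" for A B L
  proof -
    have "finite A" "finite B" using that FG(3,4) by (meson finite_UnI finite_subset)+
    moreover have "A \<inter> (+) t ` B = {}" using disj that by blast
    ultimately have "card ((A \<inter> L) \<union> ((+) t ` B \<inter> L)) = card (A \<inter> L) + card ((+) t ` B \<inter> L)"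
      by (intro card_Un_disjoint) auto
    then show ?thesis unfolding card_translate_inter by (simp add: Int_Un_distrib2)
  qed
  have eqs: "xray (s i) ?F = xray (s i) ?G" if "i \<in> {1..Suc k}" for i
  proof (rule xray_eqI)
    fix L assume L: "L \<in> parallel_lines (s i)"
    show "card (?F \<inter> L) = card (?G \<inter> L)"
    proof (cases "i = Suc k")
      case True
      have "(+) (- t) ` L = L"
        using translate_along_parallel_line[OF L, of "- real n"] True by (simp add: t_def)
      then show ?thesis by (simp add: card_Un)
    next
      case False
      then have i: "i \<in> {1..k}" using that by auto
      have "card (F \<inter> K) = card (G \<inter> K)" if "K \<in> parallel_lines (s i)" for K
        using xray_eq_lineD[OF FG(7)[OF i] that] .
      from this[OF L] this[OF translate_parallel_line[OF L, of "- t"]] show ?thesis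
        by (simp only: card_Un[OF Un_upper1 Un_upper2] card_Un[OF Un_upper2 Un_upper1])
    qed
  qed
  have "?F \<inter> ?H = F" "?G \<inter> ?H = G" using disj by blast+
  then have "?F \<noteq> ?G" using FG(6) by metis
  moreover have "card ?F = card ?G" using card_Un[of F G UNIV] card_Un[of G F UNIV] FG(5)
    by (simp add: surj_plus)
  moreover have "?F \<subseteq> integer_lattice" "?G \<subseteq> integer_lattice" using FG(1,2) tl by blast+
  moreover have "finite ?F" "finite ?G" using FG(3,4) by simp_all
  ultimately show ?case using eqs by blast
qed

text \<open>Since admissible sets exist, the least element in the definition of \<open>psi\<close> is attained.\<close>
lemma psi_attained:
  assumes "2 \<le> m"
  shows "\<exists>s F G. admissible_directions m s \<and> F \<subseteq> integer_lattice \<and> G \<subseteq> integer_lattice \<and>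
    finite F \<and> finite G \<and> card F = psi m \<and> card G = psi m \<and> F \<noteq> G \<and>
    (\<forall>i\<in>{1..m}. xray (s i) F = xray (s i) G)"
proof -
  \<comment> \<open>Lattice directions of different slopes, with the first coordinate 1 that the construction relies on.\<close>
  define s :: "nat \<Rightarrow> real^2" where "s i = vector [1, real i]" for i
  have s: "s i $ 1 = 1" "s i $ 2 = real i" for i by (simp_all add: s_def)
  have lat: "s i \<in> integer_lattice" for i using s by (simp add: integer_lattice_def forall_2)
  have ne: "s i \<noteq> 0" for i using s(1)[of i] by auto
  have indep: "independent {s i, s j}" and neq: "s i \<noteq> s j" if "i \<noteq> j" for i j
  proof -
    show "s i \<noteq> s j" using s(2)[of i] s(2)[of j] that by auto
    have "s i \<noteq> c *\<^sub>R s j" for c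
    proof
      assume "s i = c *\<^sub>R s j"
      then have "s i $ 1 = c * s j $ 1" "s i $ 2 = c * s j $ 2" by simp_all
      then show False using s that by simp
    qed
    then have "s i \<notin> span {s j}" by (auto simp: span_singleton)
    then show "independent {s i, s j}" using ne by (simp add: independent_insert)
  qed
  have "x \<in> span (s ` {1..m})" for x
  proof -
    have "x = (2 * x $ 1 - x $ 2) *\<^sub>R s 1 + (x $ 2 - x $ 1) *\<^sub>R s 2"
      by (simp add: vec_eq_iff forall_2 s)
    moreover have "s 1 \<in> span (s ` {1..m})" "s 2 \<in> span (s ` {1..m})"
      using assms by (auto intro: span_base)
    ultimately show ?thesis by (metis span_add span_scale)
  qed
  then have adm: "admissible_directions m s"
    unfolding admissible_directions_def using ne indep neq by blast
  obtain F G where FG: "F \<subseteq> integer_lattice" "G \<subseteq> integer_lattice" "finite F" "finite G"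
    "card F = card G" "F \<noteq> G" "\<forall>i\<in>{1..m}. xray (s i) F = xray (s i) G"
    using switching_component_exists[of s m, OF lat s(1)] by blast
  have "\<exists>n s. admissible_directions m s \<and> (\<exists>F G. F \<subseteq> integer_lattice \<and> G \<subseteq> integer_lattice \<and>
        finite F \<and> finite G \<and> card F = n \<and> card G = n \<and> F \<noteq> G \<and>
        (\<forall>i\<in>{1..m}. xray (s i) F = xray (s i) G))"
    using adm FG by metis
  from LeastI_ex[OF this] show ?thesis unfolding psi_def by blast
qed

theorem theorem2p2:
  fixes m :: nat
  assumes "m = 5 \<or> m > 6"
  shows "psi m \<ge> m + 1"
proof (rule ccontr)
  assume "\<not> psi m \<ge> m + 1"
  then have le: "psi m \<le> m" by simp
  have m: "2 < m" "2 \<le> m" using assms by auto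
  obtain s F G where *: "admissible_directions m s" "F \<subseteq> integer_lattice" "G \<subseteq> integer_lattice"
    "finite F" "finite G" "card F = psi m" "card G = psi m" "F \<noteq> G"
    "\<forall>i\<in>{1..m}. xray (s i) F = xray (s i) G"
    using psi_attained[OF m(2)] by blast
  interpret matched_configuration "F \<union> G" "s ` {1..m} \<union> uminus ` s ` {1..m}" m
    by (rule matched_configuration_of_xrays) (use * m le in auto)
  have "m \<in> {3, 4, 6}" using lattice_configuration_order * by blast
  then show False using assms by auto
qed

end
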